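(* Let $\omega\in(0,1/2)$ and $\delta\in(0,\pi)$ be fixed, let $\alpha\in(1,3)$, and let $$\lambda_\delta(n)=2(3-\alpha)\,\delta^{-(3-\alpha)}\,n^{\alpha-1}\int_0^{n\delta}\frac{1-\cos t}{t^\alpha}\,dt,\qquad n\in\mathbb{Z}^+ .$$ For $\gamma>0$ let $N^*(\gamma)$ be the optimal number of bubbles, i.e. the largest minimizer over $N\in\mathbb{Z}^+$ of $$E^{\mathrm{tot}}(N,\gamma)=2N+\frac{2\gamma}{\pi}\sum_{m=1}^{\infty}\frac{1}{\lambda_\delta(mN)}\left(\frac{\sin(m\pi\omega)}{m}\right)^2 .$$ Then $N^*(\gamma)$, as a function of $\gamma\in(0,\infty)$, is monotonically increasing (i.e. nondecreasing) with no upper bound.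
   Context: The numbers $\lambda_\delta(n)$ are the eigenvalues (on $e^{inx}$, with $2\pi$-periodic boundary conditions) of the one-dimensional nonlocal operator with power kernel $\rho_\delta(s)=\frac{3-\alpha}{\delta^{3-\alpha}|s|^\alpha}$, $0<|s|\le\delta$. *)

theory Defs
  imports "HOL-Analysis.Analysis"
begin

text \<open>
  The integrand is absolutely integrable near \<open>0\<close> for \<open>\<alpha> < 3\<close>;
  at the single point \<open>t = 0\<close> it takes the HOL value \<open>0 / 0 = 0\<close>,
  which does not affect the integral.
\<close>

definition nonlocal_eigenvalue :: "real \<Rightarrow> real \<Rightarrow> nat \<Rightarrow> real" where
  "nonlocal_eigenvalue \<alpha> \<delta> n =
     2 * (3 - \<alpha>) * \<delta> powr (- (3 - \<alpha>)) * real n powr (\<alpha> - 1)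
       * integral {0..real n * \<delta>} (\<lambda>t. (1 - cos t) / t powr \<alpha>)"

text \<open>The series over \<open>m \<ge> 1\<close> is indexed by \<open>Suc m\<close> with \<open>m \<ge> 0\<close>.\<close>

definition total_energy :: "real \<Rightarrow> real \<Rightarrow> real \<Rightarrow> real \<Rightarrow> nat \<Rightarrow> real" where
  "total_energy \<alpha> \<delta> \<omega> \<gamma> N =
     2 * real N + 2 * \<gamma> / pi *
       (\<Sum>m. 1 / nonlocal_eigenvalue \<alpha> \<delta> (Suc m * N)
              * (sin (real (Suc m) * pi * \<omega>) / real (Suc m))\<^sup>2)"

definition minimizes_energy :: "real \<Rightarrow> real \<Rightarrow> real \<Rightarrow> real \<Rightarrow> nat \<Rightarrow> bool" where
  "minimizes_energy \<alpha> \<delta> \<omega> \<gamma> N \<longleftrightarrow>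
     is_arg_min (total_energy \<alpha> \<delta> \<omega> \<gamma>) (\<lambda>N. 1 \<le> N) N"

definition optimal_bubbles :: "real \<Rightarrow> real \<Rightarrow> real \<Rightarrow> real \<Rightarrow> nat" where
  "optimal_bubbles \<alpha> \<delta> \<omega> \<gamma> = (GREATEST N. minimizes_energy \<alpha> \<delta> \<omega> \<gamma> N)"

end

theory Submission
  imports Defs
begin

text \<open>
  Write the energy as \<open>2 N + \<gamma> F N\<close>, where \<open>F\<close> does not depend on \<open>\<gamma>\<close>. The whole theorem
  follows from two facts about \<open>F\<close>: it is positive on the positive integers, and it tends to 0.

  Positivity makes the energy at least \<open>2 N\<close>, so minimizers exist and there are finitely many of
  them (\<open>greatest_minimizer_of_coercive\<close>). They move upwards with \<open>\<gamma>\<close>, because raising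
  \<open>N\<close> has a cost that is independent of \<open>\<gamma>\<close> and a benefit that is proportional to \<open>\<gamma>\<close>: an
  increase that pays at one value of \<open>\<gamma>\<close> pays even more at a larger one
  (\<open>minimizers_increase_with_weight\<close>). They cannot stay below a bound \<open>B\<close>: some \<open>M\<close> has
  \<open>F M\<close> below the least of \<open>F 1, \<dots>, F B\<close>, which is positive, and for large \<open>\<gamma>\<close> the
  energy at \<open>M\<close> undercuts the energies at \<open>1, \<dots>, B\<close> (\<open>minimizers_unbounded\<close>).

  The two facts about \<open>F\<close> come from the bound \<open>\<lambda>\<^sub>\<delta>(n) \<ge> c n powr (\<alpha> - 1)\<close> with \<open>c > 0\<close>
  (\<open>nonlocal_eigenvalue_lower_bound\<close>), which holds since the integrals in the eigenvalues all
  dominate the same positive integral over \<open>[\<delta>/2, \<delta>]\<close>. The series in \<open>F N\<close> is therefore at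
  most \<open>1 / (c N powr (\<alpha> - 1))\<close> times a convergent series that does not depend on \<open>N\<close>;
  its terms are nonnegative, and the first one is positive because \<open>0 < \<omega> < 1\<close>
  (\<open>long_range_energy_bounds\<close>).
\<close>


section \<open>Minimizers of a cost plus a weighted penalty\<close>

lemma finite_minimizers_of_coercive:
  fixes f :: "nat \<Rightarrow> real"
  assumes "\<And>N. 1 \<le> N \<Longrightarrow> real N \<le> f N"
  shows "finite {N. is_arg_min f (\<lambda>N. 1 \<le> N) N}"
proof (rule finite_subset)
  show "{N. is_arg_min f (\<lambda>N. 1 \<le> N) N} \<subseteq> {..nat \<lfloor>f 1\<rfloor>}"
  proof
    fix N assume "N \<in> {N. is_arg_min f (\<lambda>N. 1 \<le> N) N}"
    then have "1 \<le> N" "f N \<le> f 1"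
      by (auto simp: is_arg_min_def not_less)
    with assms[of N] have "real N \<le> f 1" by linarith
    then show "N \<in> {..nat \<lfloor>f 1\<rfloor>}"
      by (simp add: le_nat_floor)
  qed
qed simp

text \<open>A minimizer over the finitely many candidates up to \<open>f 1\<close> is a global one, because beyond
  them \<open>f\<close> already exceeds \<open>f 1\<close>.\<close>

lemma minimizer_exists_of_coercive:
  fixes f :: "nat \<Rightarrow> real"
  assumes "\<And>N. 1 \<le> N \<Longrightarrow> real N \<le> f N"
  shows "\<exists>N. is_arg_min f (\<lambda>N. 1 \<le> N) N"
proof -
  define A where "A = {1..max 1 (nat \<lfloor>f 1\<rfloor>)}"
  have fin: "finite A" "A \<noteq> {}" by (auto simp: A_def)
  define K where "K = arg_min_on f A"
  have K: "K \<in> A" "\<And>N. N \<in> A \<Longrightarrow> f K \<le> f N"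
    using arg_min_if_finite[OF fin, of f] by (auto simp: K_def not_less)
  have "f K \<le> f N" if "1 \<le> N" for N
  proof (cases "N \<in> A")
    case False
    then have "\<not> real N \<le> f 1"
      using that le_nat_floor[of N "f 1"] by (auto simp: A_def)
    moreover have "f K \<le> f 1" by (rule K) (simp add: A_def)
    ultimately show ?thesis using assms[OF that] by linarith
  qed (rule K)
  then show ?thesis
    using K(1) by (auto simp: is_arg_min_def not_less A_def)
qed

lemma greatest_minimizer_of_coercive:
  fixes f :: "nat \<Rightarrow> real"
  assumes "\<And>N. 1 \<le> N \<Longrightarrow> real N \<le> f N"
  defines "K \<equiv> GREATEST N. is_arg_min f (\<lambda>N. 1 \<le> N) N"
  shows "is_arg_min f (\<lambda>N. 1 \<le> N) K"
    and "is_arg_min f (\<lambda>N. 1 \<le> N) N \<Longrightarrow> N \<le> K"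
proof -
  let ?P = "is_arg_min f (\<lambda>N. 1 \<le> N)"
  obtain N0 where N0: "?P N0"
    using minimizer_exists_of_coercive[of f] assms by blast
  have bnd: "\<forall>y. ?P y \<longrightarrow> y \<le> Max {N. ?P N}"
    using finite_minimizers_of_coercive[of f] assms by auto
  show "?P K"
    unfolding K_def using N0 bnd by (metis GreatestI_nat)
  show "N \<le> K" if "?P N"
    unfolding K_def using that bnd by (metis Greatest_le_nat)
qed

text \<open>An exchange argument: if \<open>N < K\<close>, optimality of \<open>K\<close> at weight \<open>g\<close> means that the
  saving \<open>g * (F N - F K)\<close> covers the cost \<open>c K - c N > 0\<close>; at weight \<open>h\<close> it would exceed the
  cost, so \<open>N\<close> would not be optimal there.\<close>

lemma minimizers_increase_with_weight:
  fixes c F :: "nat \<Rightarrow> real"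
  assumes "0 < g" and "g < h" and "strict_mono c"
    and K: "is_arg_min (\<lambda>N. c N + g * F N) P K"
    and N: "is_arg_min (\<lambda>N. c N + h * F N) P N"
  shows "K \<le> N"
proof (rule ccontr)
  assume "\<not> K \<le> N"
  then have "c N < c K" using \<open>strict_mono c\<close> by (simp add: strict_mono_less)
  have at_g: "c K + g * F K \<le> c N + g * F N" and at_h: "c N + h * F N \<le> c K + h * F K"
    using K N by (auto simp: is_arg_min_def not_less)
  from at_g \<open>c N < c K\<close> have "0 < g * (F N - F K)" by (simp add: algebra_simps)
  with \<open>0 < g\<close> have "0 < F N - F K" by (simp add: zero_less_mult_iff)
  with \<open>g < h\<close> have "g * (F N - F K) < h * (F N - F K)" by simp
  with at_g at_h show False by (simp add: algebra_simps)
qed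

lemma minimizers_unbounded:
  fixes c F :: "nat \<Rightarrow> real"
  assumes cpos: "\<And>N. 0 \<le> c N"
    and Fpos: "\<And>N. 1 \<le> N \<Longrightarrow> 0 < F N" and Flim: "F \<longlonglongrightarrow> 0"
  shows "\<exists>g>0. \<forall>N. is_arg_min (\<lambda>N. c N + g * F N) (\<lambda>N. 1 \<le> N) N \<longrightarrow> B < N"
proof -
  define f where "f = Min (F ` {1..Suc B})"
  have f: "0 < f" "\<And>N. 1 \<le> N \<Longrightarrow> N \<le> B \<Longrightarrow> f \<le> F N"
    using Fpos by (auto simp: f_def)
  have "\<forall>\<^sub>F M in sequentially. F M < f \<and> 1 \<le> M"
    using order_tendstoD(2)[OF Flim \<open>0 < f\<close>] eventually_ge_at_top[of 1]
    by eventually_elim simp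
  then obtain M where M: "F M < f" "1 \<le> M"
    by (auto simp: eventually_sequentially)
  \<comment> \<open>With this weight the gain \<open>f - F M\<close> in the penalty outweighs the cost \<open>c M\<close>.\<close>
  define g where "g = (c M + 1) / (f - F M)"
  have "0 < g" using M cpos[of M] by (simp add: g_def)
  have gain: "g * (f - F M) = c M + 1" using M by (simp add: g_def)
  have "B < N" if "is_arg_min (\<lambda>N. c N + g * F N) (\<lambda>N. 1 \<le> N) N" for N
  proof (rule ccontr)
    assume "\<not> B < N"
    have "1 \<le> N" and le: "c N + g * F N \<le> c M + g * F M"
      using that M(2) by (auto simp: is_arg_min_def not_less)
    with \<open>\<not> B < N\<close> f \<open>0 < g\<close> have "g * f \<le> g * F N" by simp
    with le gain cpos[of N] show False by (simp add: algebra_simps)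
  qed
  with \<open>0 < g\<close> show ?thesis by blast
qed


section \<open>Growth of the eigenvalues\<close>

text \<open>The singularity at 0 is integrable because \<open>1 - cos t\<close> vanishes to second order there and
  \<open>2 - \<alpha> > -1\<close>.\<close>

lemma integrable_one_minus_cos_over_powr:
  fixes \<alpha> b :: real
  assumes "\<alpha> < 3" and "0 \<le> b"
  shows "(\<lambda>t. (1 - cos t) / t powr \<alpha>) integrable_on {0..b}"
proof (rule measurable_bounded_by_integrable_imp_integrable_real)
  show "(\<lambda>t. (1 - cos t) / t powr \<alpha>) \<in> borel_measurable (lebesgue_on {0..b})"
    by (intro measurable_restrict_space1 measurable_completion) simp
  show "(\<lambda>t. t powr (2 - \<alpha>)) integrable_on {0..b}"
    using assms by (intro integrable_on_powr_from_0) auto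
  fix t assume "t \<in> {0..b}"
  then have "0 \<le> t" by simp
  have "1 - cos t = 2 * (sin (t / 2))\<^sup>2"
    using cos_double_sin[of "t / 2"] by simp
  also have "\<dots> \<le> 2 * (t / 2)\<^sup>2"
    using abs_sin_x_le_abs_x[of "t / 2"] by (simp only: abs_le_square_iff)
  also have "\<dots> \<le> t\<^sup>2" by (simp add: power_divide)
  finally have "1 - cos t \<le> t\<^sup>2" .
  then have "(1 - cos t) / t powr \<alpha> \<le> t\<^sup>2 / t powr \<alpha>"
    by (simp add: divide_right_mono)
  also have "\<dots> = t powr (2 - \<alpha>)"
    using \<open>0 \<le> t\<close> by (cases "t = 0") (auto simp: powr_diff)
  finally show "\<bar>(1 - cos t) / t powr \<alpha>\<bar> \<le> t powr (2 - \<alpha>)" by simp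
qed auto

text \<open>On \<open>[\<delta>/2, \<delta>]\<close> the integrand is bounded below by its least numerator over its largest
  denominator. Since \<open>b\<close> does not occur in the bound, it serves for all eigenvalues at
  once.\<close>

lemma integral_one_minus_cos_lower_bound:
  fixes \<alpha> \<delta> b :: real
  assumes "0 < \<delta>" and "\<delta> < pi" and "0 \<le> \<alpha>" and "\<alpha> < 3" and "\<delta> \<le> b"
  shows "(1 - cos (\<delta> / 2)) / \<delta> powr \<alpha> * (\<delta> / 2)
           \<le> integral {0..b} (\<lambda>t. (1 - cos t) / t powr \<alpha>)"
proof -
  let ?f = "\<lambda>t. (1 - cos t) / t powr \<alpha>"
  let ?k = "(1 - cos (\<delta> / 2)) / \<delta> powr \<alpha>"
  have int: "?f integrable_on {0..b}"
    using assms by (intro integrable_one_minus_cos_over_powr) auto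
  have int': "?f integrable_on {\<delta> / 2..\<delta>}"
    using assms by (intro integrable_on_subinterval[OF int]) auto
  have "?k * (\<delta> / 2) = integral {\<delta> / 2..\<delta>} (\<lambda>t. ?k)"
    using assms by (simp add: mult.commute)
  also have "\<dots> \<le> integral {\<delta> / 2..\<delta>} ?f"
  proof (rule integral_le[OF _ int'])
    fix t assume t: "t \<in> {\<delta> / 2..\<delta>}"
    have "cos t \<le> cos (\<delta> / 2)"
      using t assms by (intro cos_monotone_0_pi_le) auto
    moreover have "t powr \<alpha> \<le> \<delta> powr \<alpha>"
      using t assms by (intro powr_mono2) auto
    ultimately show "?k \<le> ?f t"
      using t assms by (intro frac_le) auto
  qed auto
  also have "\<dots> \<le> integral {0..b} ?f"
    using assms by (intro integral_subset_le int int') auto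
  finally show ?thesis .
qed

lemma nonlocal_eigenvalue_lower_bound:
  fixes \<alpha> \<delta> :: real
  assumes "0 < \<delta>" and "\<delta> < pi" and "0 \<le> \<alpha>" and "\<alpha> < 3"
  shows "\<exists>c>0. \<forall>n\<ge>1. c * real n powr (\<alpha> - 1) \<le> nonlocal_eigenvalue \<alpha> \<delta> n"
proof (intro exI conjI allI impI)
  let ?J = "(1 - cos (\<delta> / 2)) / \<delta> powr \<alpha> * (\<delta> / 2)"
  let ?p = "2 * (3 - \<alpha>) * \<delta> powr (- (3 - \<alpha>))"
  have "cos (\<delta> / 2) < cos 0"
    using assms by (intro cos_monotone_0_pi) auto
  then show "0 < ?p * ?J"
    using assms by simp
  fix n :: nat assume "1 \<le> n"
  then have "\<delta> \<le> real n * \<delta>" using \<open>0 < \<delta>\<close> by simp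
  then have "?p * real n powr (\<alpha> - 1) * ?J \<le> nonlocal_eigenvalue \<alpha> \<delta> n"
    unfolding nonlocal_eigenvalue_def
    using assms by (intro mult_left_mono integral_one_minus_cos_lower_bound) auto
  then show "?p * ?J * real n powr (\<alpha> - 1) \<le> nonlocal_eigenvalue \<alpha> \<delta> n"
    by (simp add: mult_ac)
qed


section \<open>The long-range part of the energy\<close>

definition bubble_weight :: "real \<Rightarrow> nat \<Rightarrow> real" where
  "bubble_weight \<omega> m = (sin (real (Suc m) * pi * \<omega>) / real (Suc m))\<^sup>2"

definition long_range_energy :: "real \<Rightarrow> real \<Rightarrow> real \<Rightarrow> nat \<Rightarrow> real" where
  "long_range_energy \<alpha> \<delta> \<omega> N =
     2 / pi * (\<Sum>m. 1 / nonlocal_eigenvalue \<alpha> \<delta> (Suc m * N) * bubble_weight \<omega> m)"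

lemma total_energy_eq:
  "total_energy \<alpha> \<delta> \<omega> \<gamma> = (\<lambda>N. 2 * real N + \<gamma> * long_range_energy \<alpha> \<delta> \<omega> N)"
  by (simp add: total_energy_def long_range_energy_def bubble_weight_def fun_eq_iff)

lemma summable_bubble_weight: "summable (bubble_weight \<omega>)"
proof (rule summable_comparison_test')
  show "summable (\<lambda>m. inverse (real (Suc m) ^ 2))"
    using inverse_power_summable[of 2, where ?'a = real]
    by (subst summable_Suc_iff) simp
  show "norm (bubble_weight \<omega> m) \<le> inverse (real (Suc m) ^ 2)" if "0 \<le> m" for m
    by (simp add: bubble_weight_def power_divide divide_simps abs_square_le_1)
qed

text \<open>The \<open>m\<close>-th eigenvalue in the series is at least the bound \<open>r\<close> for the index \<open>N\<close>,
  because \<open>n powr (\<alpha> - 1)\<close> does not decrease in \<open>n\<close>. So \<open>bubble_weight \<omega> m / r\<close> dominates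
  the series. This gives the upper bound, and the convergence without which the sum would not
  inherit the positivity of its first term.\<close>

lemma long_range_energy_bounds:
  fixes \<alpha> \<delta> \<omega> :: real
  assumes "0 < \<omega>" and "\<omega> < 1"
    and "0 < c" and eig: "\<And>n. 1 \<le> n \<Longrightarrow> c * real n powr (\<alpha> - 1) \<le> nonlocal_eigenvalue \<alpha> \<delta> n"
    and "1 \<le> \<alpha>" and "1 \<le> N"
  shows "0 < long_range_energy \<alpha> \<delta> \<omega> N"
    and "long_range_energy \<alpha> \<delta> \<omega> N \<le> 2 / (pi * c) * suminf (bubble_weight \<omega>) * real N powr (1 - \<alpha>)"
proof -
  define r where "r = c * real N powr (\<alpha> - 1)"
  have "0 < r" using assms by (simp add: r_def)
  let ?l = "\<lambda>m. nonlocal_eigenvalue \<alpha> \<delta> (Suc m * N)"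
  let ?t = "\<lambda>m. 1 / ?l m * bubble_weight \<omega> m"
  have r_le: "r \<le> ?l m" for m
  proof -
    have "real N powr (\<alpha> - 1) \<le> real (Suc m * N) powr (\<alpha> - 1)"
      using assms by (intro powr_mono2) auto
    then have "r \<le> c * real (Suc m * N) powr (\<alpha> - 1)"
      unfolding r_def using \<open>0 < c\<close> by simp
    also have "\<dots> \<le> ?l m" using \<open>1 \<le> N\<close> by (intro eig) simp
    finally show ?thesis .
  qed
  have lpos: "0 < ?l m" for m using r_le[of m] \<open>0 < r\<close> by linarith
  have w_nonneg: "0 \<le> bubble_weight \<omega> m" for m by (simp add: bubble_weight_def)
  have t_nonneg: "0 \<le> ?t m" for m
    using lpos[of m] w_nonneg[of m] by simp
  have t_le: "?t m \<le> 1 / r * bubble_weight \<omega> m" for m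
    using r_le[of m] \<open>0 < r\<close> w_nonneg[of m] by (intro mult_right_mono divide_left_mono) auto
  have sum': "summable (\<lambda>m. 1 / r * bubble_weight \<omega> m)"
    by (rule summable_mult[OF summable_bubble_weight])
  have sum: "summable ?t"
  proof (rule summable_comparison_test'[OF sum', of 0])
    show "norm (?t m) \<le> 1 / r * bubble_weight \<omega> m" for m
      using t_le[of m] t_nonneg[of m] by (simp only: real_norm_def abs_of_nonneg)
  qed
  have "0 < sin (pi * \<omega>)"
    using assms by (intro sin_gt_zero) auto
  then have "0 < ?t 0"
    using lpos[of 0] by (simp add: bubble_weight_def)
  then have "0 < suminf ?t"
    by (rule suminf_pos2[OF sum t_nonneg])
  then show "0 < long_range_energy \<alpha> \<delta> \<omega> N"
    by (simp add: long_range_energy_def)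
  have "suminf ?t \<le> (\<Sum>m. 1 / r * bubble_weight \<omega> m)"
    by (rule suminf_le[OF t_le sum sum'])
  also have "\<dots> = 1 / r * suminf (bubble_weight \<omega>)"
    by (rule suminf_mult[OF summable_bubble_weight])
  finally have "long_range_energy \<alpha> \<delta> \<omega> N \<le> 2 / pi * (1 / r * suminf (bubble_weight \<omega>))"
    unfolding long_range_energy_def by (intro mult_left_mono) auto
  also have "1 / r = real N powr (1 - \<alpha>) / c"
    using powr_minus_divide[of "real N" "\<alpha> - 1"] by (simp add: r_def)
  finally show "long_range_energy \<alpha> \<delta> \<omega> N
      \<le> 2 / (pi * c) * suminf (bubble_weight \<omega>) * real N powr (1 - \<alpha>)"
    by (simp add: mult_ac)
qed

theorem theorem3p3:
  fixes \<alpha> \<delta> \<omega> :: real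
  assumes "0 < \<omega>" and "\<omega> < 1 / 2"
    and "0 < \<delta>" and "\<delta> < pi"
    and "1 < \<alpha>" and "\<alpha> < 3"
  shows "(\<forall>\<gamma>>0. minimizes_energy \<alpha> \<delta> \<omega> \<gamma> (optimal_bubbles \<alpha> \<delta> \<omega> \<gamma>)
            \<and> (\<forall>N. minimizes_energy \<alpha> \<delta> \<omega> \<gamma> N \<longrightarrow> N \<le> optimal_bubbles \<alpha> \<delta> \<omega> \<gamma>))
         \<and> mono_on {0<..} (optimal_bubbles \<alpha> \<delta> \<omega>)
         \<and> \<not> bdd_above (optimal_bubbles \<alpha> \<delta> \<omega> ` {0<..})"
proof -
  let ?F = "long_range_energy \<alpha> \<delta> \<omega>"
  let ?opt = "optimal_bubbles \<alpha> \<delta> \<omega>"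
  obtain c where "0 < c"
    and eig: "\<And>n. 1 \<le> n \<Longrightarrow> c * real n powr (\<alpha> - 1) \<le> nonlocal_eigenvalue \<alpha> \<delta> n"
    using nonlocal_eigenvalue_lower_bound[of \<delta> \<alpha>] assms by auto
  have Fpos: "0 < ?F N" if "1 \<le> N" for N
    using assms that by (intro long_range_energy_bounds(1)[OF _ _ \<open>0 < c\<close> eig]) auto
  let ?C = "2 / (pi * c) * suminf (bubble_weight \<omega>)"
  have Fle: "?F N \<le> ?C * real N powr (1 - \<alpha>)" if "1 \<le> N" for N
    using assms that by (intro long_range_energy_bounds(2)[OF _ _ \<open>0 < c\<close> eig]) auto
  have "(\<lambda>N. real N powr (1 - \<alpha>)) \<longlonglongrightarrow> 0"
    using \<open>1 < \<alpha>\<close> by (intro tendsto_neg_powr filterlim_real_sequentially) simp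
  then have "(\<lambda>N. ?C * real N powr (1 - \<alpha>)) \<longlonglongrightarrow> 0"
    by (rule tendsto_mult_right_zero)
  then have Flim: "?F \<longlonglongrightarrow> 0"
  proof (rule real_tendsto_sandwich[OF _ _ tendsto_const, rotated 2])
    show "\<forall>\<^sub>F N in sequentially. 0 \<le> ?F N"
      using eventually_ge_at_top[of 1] by eventually_elim (simp add: Fpos less_imp_le)
    show "\<forall>\<^sub>F N in sequentially. ?F N \<le> ?C * real N powr (1 - \<alpha>)"
      using eventually_ge_at_top[of 1] by eventually_elim (rule Fle)
  qed
  have min_eq: "minimizes_energy \<alpha> \<delta> \<omega> \<gamma>
      = is_arg_min (\<lambda>N. 2 * real N + \<gamma> * ?F N) (\<lambda>N. 1 \<le> N)" for \<gamma>
    by (simp add: minimizes_energy_def fun_eq_iff total_energy_eq)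
  have greatest: "minimizes_energy \<alpha> \<delta> \<omega> \<gamma> (?opt \<gamma>)"
      "minimizes_energy \<alpha> \<delta> \<omega> \<gamma> N \<Longrightarrow> N \<le> ?opt \<gamma>" if "0 < \<gamma>" for \<gamma> N
  proof -
    have coercive: "real N \<le> 2 * real N + \<gamma> * ?F N" if "1 \<le> N" for N
      using \<open>0 < \<gamma>\<close> Fpos[OF that] by (simp add: add_nonneg_nonneg)
    note greatest_minimizer_of_coercive[OF coercive]
    then show "minimizes_energy \<alpha> \<delta> \<omega> \<gamma> (?opt \<gamma>)"
      "minimizes_energy \<alpha> \<delta> \<omega> \<gamma> N \<Longrightarrow> N \<le> ?opt \<gamma>"
      unfolding optimal_bubbles_def min_eq by blast+
  qed
  have mono: "mono_on {0<..} ?opt"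
  proof (rule mono_onI)
    fix g h :: real assume gh: "g \<in> {0<..}" "h \<in> {0<..}" "g \<le> h"
    show "?opt g \<le> ?opt h"
    proof (cases "g = h")
      case False
      show ?thesis
      proof (rule minimizers_increase_with_weight)
        show "0 < g" "g < h" using gh False by auto
        show "strict_mono (\<lambda>N. 2 * real N)" by (simp add: strict_mono_def)
      qed (use gh greatest(1)[of g] greatest(1)[of h] in \<open>auto simp: min_eq\<close>)
    qed simp
  qed
  have unbounded: "\<not> bdd_above (?opt ` {0<..})"
  proof
    assume "bdd_above (?opt ` {0<..})"
    then obtain B where B: "\<And>\<gamma>. 0 < \<gamma> \<Longrightarrow> ?opt \<gamma> \<le> B"
      by (auto simp: bdd_above_def)
    obtain \<gamma> where "0 < \<gamma>" and large: "\<And>N. minimizes_energy \<alpha> \<delta> \<omega> \<gamma> N \<Longrightarrow> B < N"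
      using minimizers_unbounded[of "\<lambda>N. 2 * real N" ?F B] Fpos Flim by (auto simp: min_eq)
    from large[OF greatest(1)] B \<open>0 < \<gamma>\<close> show False by (meson leD)
  qed
  show ?thesis by (intro conjI allI impI greatest mono unbounded)
qed

end
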